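(* Let $q$ be a prime power, let $F$ be a field containing $\mathbb{F}_q$, let $d\ge 0$, and let $f(z)=\sum_{i=0}^{d} f_i z^{q^i}\in F[z]$ with $f_d\neq 0$. Put $u=1/z$ and expand $-zf'(z)/(1-f(z))=\sum_{i\ge 0}\mathcal{A}_i u^i$ as a power series in $u$. Then for every integer $s$ with $1\le s<q$ and all integers $k_1,\dots,k_s\ge 0$, $$\prod_{j=1}^s \mathcal{A}_{q^{k_j}-1} = f_0^{s-1}\, \mathcal{A}_{q^{k_1}+\dots+q^{k_s}-1}.$$
   Context: Here $f'(z)=f_0$, and $zf'(z)/(1-f(z))=f_0z/(1-f(z))$ is a power series in $u=1/z$ since $f$ is a polynomial of degree $q^d$. *)

theory Defs
  imports
    "HOL-Algebra.Algebraic_Closure_Type"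
    "HOL-Computational_Algebra.Computational_Algebra"
    "HOL-Number_Theory.Prime_Powers"
begin

definition q_poly :: "nat \<Rightarrow> nat \<Rightarrow> (nat \<Rightarrow> 'a::field) \<Rightarrow> 'a poly" where
  "q_poly q d c = (\<Sum>i\<le>d. Polynomial.monom (c i) (q ^ i))"

text \<open>
  Laurent series over \<open>'a\<close> are taken in the variable \<open>u\<close> (\<^const>\<open>fls_X\<close>). The polynomial \<open>p(z)\<close>
  is expanded at infinity by putting \<open>z = 1/u\<close>, and a quotient of polynomials is expanded by
  dividing in the field of Laurent series.
\<close>

definition at_infinity_fls :: "'a::field poly \<Rightarrow> 'a fls" where
  "at_infinity_fls p = poly (map_poly fls_const p) fls_X_inv"

definition z_log_deriv_fls :: "'a::field poly \<Rightarrow> 'a fls" where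
  "z_log_deriv_fls f =
     - (at_infinity_fls ([:0, 1:] * pderiv f) / at_infinity_fls (1 - f))"

definition A_coeff :: "'a::field poly \<Rightarrow> nat \<Rightarrow> 'a" where
  "A_coeff f i = fls_nth (z_log_deriv_fls f) (int i)"

text \<open>
  The remaining facts show that the expansion is a power series in \<open>u\<close> (there are no terms of
  negative index), so that its coefficients are exactly the values of \<^const>\<open>A_coeff\<close>.
\<close>

lemma at_infinity_fls_nth:
  "fls_nth (at_infinity_fls p) n =
     (if n \<le> 0 then Polynomial.coeff p (nat (- n)) else 0)"
proof -
  have "at_infinity_fls p = (\<Sum>i\<le>Polynomial.degree p.
      fls_const (Polynomial.coeff p i) * fls_X_inv ^ i)"
    by (simp add: at_infinity_fls_def poly_altdef coeff_map_poly degree_map_poly)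
  hence "fls_nth (at_infinity_fls p) n = (\<Sum>i\<le>Polynomial.degree p.
      if n = - int i then Polynomial.coeff p i else 0)"
    by (simp add: fls_nth_sum fls_X_inv_power_conv_shift_1 if_distrib cong: if_cong)
       (intro sum.cong refl, auto)
  also have "\<dots> = (\<Sum>i\<le>Polynomial.degree p.
      if i = nat (- n) then (if n \<le> 0 then Polynomial.coeff p i else 0) else 0)"
    by (intro sum.cong refl) auto
  also have "\<dots> = (if n \<le> 0 then Polynomial.coeff p (nat (- n)) else 0)"
    by (auto simp: sum.delta coeff_eq_0)
  finally show ?thesis .
qed

lemma at_infinity_fls_subdegree:
  assumes "p \<noteq> 0"
  shows "fls_subdegree (at_infinity_fls p) = - int (Polynomial.degree p)"
  by (rule fls_subdegree_eqI) (use assms in \<open>auto simp: at_infinity_fls_nth coeff_eq_0\<close>)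

lemma at_infinity_fls_eq_0_iff: "at_infinity_fls p = 0 \<longleftrightarrow> p = 0"
proof
  assume "at_infinity_fls p = 0"
  hence "fls_nth (at_infinity_fls p) (- int (Polynomial.degree p)) = 0"
    by simp
  thus "p = 0" by (simp add: at_infinity_fls_nth)
qed (simp add: at_infinity_fls_def)

lemma z_log_deriv_fls_eq_power_series:
  fixes f :: "'a::field poly"
  assumes "Polynomial.degree f > 0"
  shows "z_log_deriv_fls f = fps_to_fls (Abs_fps (A_coeff f))"
proof -
  let ?a = "[:0, 1:] * pderiv f" and ?b = "1 - f"
  have degb: "Polynomial.degree ?b = Polynomial.degree f"
    using assms degree_add_eq_right[of 1 "- f"] by simp
  hence b0: "?b \<noteq> 0" using assms by auto
  have "fls_subdegree (z_log_deriv_fls f) \<ge> 0"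
  proof (cases "?a = 0")
    case True
    thus ?thesis by (simp add: z_log_deriv_fls_def at_infinity_fls_def)
  next
    case False
    have "Polynomial.degree (pderiv f) \<le> Polynomial.degree f - 1"
      by (rule degree_le) (use assms in \<open>auto simp: coeff_pderiv coeff_eq_0\<close>)
    hence "Polynomial.degree ?a \<le> Polynomial.degree f"
      using assms by (auto simp: degree_pCons_eq_if)
    thus ?thesis
      using False b0 degb
      by (simp add: z_log_deriv_fls_def fls_divide_subdegree at_infinity_fls_eq_0_iff
          at_infinity_fls_subdegree del: mult_pCons_left)
  qed
  thus ?thesis
    by (intro fls_eqI) (auto simp: A_coeff_def intro: fls_eq0_below_subdegree)
qed

lemma degree_q_poly:
  assumes "q > 1" and "c d \<noteq> 0"
  shows "Polynomial.degree (q_poly q d c) = q ^ d"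
proof (rule antisym)
  show "Polynomial.degree (q_poly q d c) \<le> q ^ d"
    unfolding q_poly_def
    by (intro degree_sum_le)
       (use assms in \<open>auto intro!: order.trans[OF degree_monom_le] power_increasing\<close>)
  have "Polynomial.coeff (q_poly q d c) (q ^ d) = (\<Sum>i\<le>d. if i = d then c i else 0)"
    using assms by (simp add: q_poly_def coeff_sum)
  also have "\<dots> = c d" by simp
  finally show "q ^ d \<le> Polynomial.degree (q_poly q d c)"
    using assms by (intro le_degree) simp
qed

lemma z_log_deriv_fls_q_poly:
  assumes "q > 1" and "c d \<noteq> 0"
  shows "z_log_deriv_fls (q_poly q d c) = fps_to_fls (Abs_fps (A_coeff (q_poly q d c)))"
  using assms by (intro z_log_deriv_fls_eq_power_series) (simp add: degree_q_poly)

end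

theory Submission
  imports Defs
begin

text \<open>
  Put \<open>g = f - 1\<close>. Since \<open>f' = f\<^sub>0\<close>, dividing \<open>z\<^sup>m = Q g + r\<close> by \<open>g\<close> and comparing coefficients
  gives \<open>\<A>\<^bsub>m-1\<^esub> = f\<^sub>0 Q(0) = f\<^sub>0 r(0)\<close>, where \<open>r = z\<^sup>m mod g\<close>. When \<open>m\<close> is a power of \<open>q\<close>, the
  remainder \<open>r\<close> is a combination of \<open>1, z, z\<^sup>q, \<dots>\<close>, so its degree is at most \<open>q\<^bsup>d-1\<^esup>\<close>
  (and \<open>0\<close> if \<open>d = 0\<close>). Hence the
  product of fewer than \<open>q\<close> such remainders is already reduced modulo \<open>g\<close>, and \<open>r(0)\<close> is
  multiplicative on the corresponding monomials.
\<close>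

lemma at_infinity_fls_pCons:
  "at_infinity_fls (pCons a p) = fls_const a + fls_X_inv * at_infinity_fls p"
  by (cases "p = 0 \<and> a = 0") (auto simp: at_infinity_fls_def map_poly_pCons)

lemma at_infinity_fls_add: "at_infinity_fls (p + r) = at_infinity_fls p + at_infinity_fls r"
  by (intro fls_eqI) (simp add: at_infinity_fls_nth)

lemma at_infinity_fls_minus: "at_infinity_fls (- p) = - at_infinity_fls p"
  by (intro fls_eqI) (simp add: at_infinity_fls_nth)

lemma at_infinity_fls_smult: "at_infinity_fls (smult a p) = fls_const a * at_infinity_fls p"
  by (intro fls_eqI) (simp add: at_infinity_fls_nth)

text \<open>Together with additivity this makes expansion at infinity a ring homomorphism, so
  division with remainder carries over to Laurent series.\<close>

lemma at_infinity_fls_mult: "at_infinity_fls (p * r) = at_infinity_fls p * at_infinity_fls r"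
proof (induction p)
  case 0
  then show ?case by (simp add: at_infinity_fls_def)
next
  case (pCons a p)
  have "at_infinity_fls (pCons a p * r) = at_infinity_fls (smult a r + pCons 0 (p * r))"
    by (simp add: mult_pCons_left)
  then show ?case
    by (simp add: at_infinity_fls_add at_infinity_fls_smult at_infinity_fls_pCons pCons.IH
        algebra_simps)
qed

text \<open>\<open>fls_shift\<close> lowers indices, so the right-hand side is
  \<open>u^(-m)\<close>.\<close>

lemma at_infinity_fls_monom: "at_infinity_fls (monom 1 m) = fls_shift (int m) 1"
  by (intro fls_eqI) (auto simp: at_infinity_fls_nth)

lemma A_coeff_eq_mod:
  fixes f :: "'a::field poly"
  assumes deriv: "pderiv f = [:a:]" and f0: "poly f 0 = 0" and deg: "degree f > 0"
    and m: "m \<ge> 1"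
  shows "A_coeff f (m - 1) = a * poly (monom 1 m mod (f - 1)) 0"
proof -
  define g where "g = f - 1"
  define Q where "Q = monom 1 m div g"
  define r where "r = monom 1 m mod g"
  let ?I = "at_infinity_fls :: 'a poly \<Rightarrow> 'a fls"
  have degg: "degree g = degree f"
    unfolding g_def using deg degree_add_eq_left[of "- 1" f] by simp
  have g0: "g \<noteq> 0" using degg deg by auto
  then have Ig: "?I g \<noteq> 0" by (simp add: at_infinity_fls_eq_0_iff)
  have div: "monom 1 m = Q * g + r" by (simp add: Q_def r_def)
  have r_deg: "r = 0 \<or> degree r < degree f"
    using degree_mod_less[OF g0, of "monom 1 m"] degg by (simp add: r_def)
  have L: "z_log_deriv_fls f = ?I [:0, a:] / ?I g"
  proof -
    have "?I (1 - f) = - ?I g"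
      by (simp add: g_def flip: at_infinity_fls_minus)
    then show ?thesis by (simp add: z_log_deriv_fls_def deriv)
  qed
  \<comment> \<open>Multiply \<open>z^m = Q g + r\<close> by \<open>a z / g\<close>. The coefficient
    at index -1, that is of \<open>z\<close>, is then read off on both sides; on the left the shift
    by \<open>m\<close> moves it to index \<open>m - 1\<close>.\<close>
  have "?I (monom 1 m) * z_log_deriv_fls f = ?I (Q * [:0, a:]) + ?I (r * [:0, a:]) / ?I g"
    using Ig by (simp add: L div at_infinity_fls_add at_infinity_fls_mult field_simps
        del: mult_pCons_left mult_pCons_right)
  then have "fls_nth (fls_shift (int m) 1 * z_log_deriv_fls f) (- 1) =
      fls_nth (?I (Q * [:0, a:])) (- 1) + fls_nth (?I (r * [:0, a:]) / ?I g) (- 1)"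
    by (simp add: at_infinity_fls_monom)
  moreover have "fls_nth (fls_shift (int m) 1 * z_log_deriv_fls f) (- 1) = A_coeff f (m - 1)"
    using m by (simp only: A_coeff_def fls_shifted_times_simps(2) fls_shift_nth mult_1_left) simp
  moreover have "fls_nth (?I (Q * [:0, a:])) (- 1) = a * poly Q 0"
    by (simp add: at_infinity_fls_nth poly_0_coeff_0)
  \<comment> \<open>As \<open>r\<close> is zero or of degree below that of \<open>g\<close>, the
    quotient \<open>a z r / g\<close> has no negative powers of \<open>u\<close>.\<close>
  moreover have "fls_nth (?I (r * [:0, a:]) / ?I g) (- 1) = 0"
  proof (cases "r * [:0, a:] = 0")
    case True
    then have "?I (r * [:0, a:]) = 0" by (simp only: at_infinity_fls_eq_0_iff)
    then show ?thesis by (simp only: div_0 fls_zero_nth)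
  next
    case False
    then have "r \<noteq> 0" "a \<noteq> 0" by auto
    then have "degree (r * [:0, a:]) \<le> degree g"
      using r_deg degg by (subst degree_mult_eq) auto
    moreover have "?I (r * [:0, a:]) \<noteq> 0"
      using False by (simp only: at_infinity_fls_eq_0_iff not_False_eq_True)
    ultimately have "fls_subdegree (?I (r * [:0, a:]) / ?I g) \<ge> 0"
      using at_infinity_fls_subdegree[OF False] at_infinity_fls_subdegree[OF g0] Ig
      by (subst fls_divide_subdegree) linarith+
    then show ?thesis by (intro fls_eq0_below_subdegree) auto
  qed
  \<comment> \<open>Evaluate the division at 0: \<open>z^m\<close> vanishes since \<open>m\<close>
    is positive, and \<open>g(0) = -1\<close>.\<close>
  moreover have "poly r 0 = poly Q 0"
  proof -
    have "poly (monom 1 m) (0::'a) = poly (Q * g + r) 0" by (simp only: div)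
    then show ?thesis using m f0 by (simp add: poly_monom g_def power_0_left)
  qed
  ultimately show ?thesis by (simp add: r_def g_def)
qed

definition affine_q_poly :: "nat \<Rightarrow> 'a::field poly \<Rightarrow> bool" where
  "affine_q_poly q p \<longleftrightarrow> (\<forall>n. coeff p n \<noteq> 0 \<longrightarrow> n = 0 \<or> (\<exists>i. n = q ^ i))"

lemma affine_q_poly_q_poly: "affine_q_poly q (q_poly q d c)"
  unfolding affine_q_poly_def q_poly_def coeff_sum coeff_monom
  by (intro allI impI, erule sum.not_neutral_contains_not_neutral) (auto split: if_splits)

lemma affine_q_poly_diff:
  "affine_q_poly q p \<Longrightarrow> affine_q_poly q r \<Longrightarrow> affine_q_poly q (p - r)"
  unfolding affine_q_poly_def by (metis coeff_diff diff_zero)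

lemma affine_q_poly_smult: "affine_q_poly q p \<Longrightarrow> affine_q_poly q (smult a p)"
  by (auto simp: affine_q_poly_def)

lemma poly_power_char:
  fixes p :: "'a::field poly"
  assumes "prime CHAR('a)" and q: "q = CHAR('a) ^ n"
  shows "p ^ q = (\<Sum>i\<le>degree p. monom (coeff p i ^ q) (i * q))"
proof -
  have "p ^ q = (\<Sum>i\<le>degree p. monom (coeff p i) i) ^ q"
    by (simp add: poly_as_sum_of_monoms)
  also have "\<dots> = (\<Sum>i\<le>degree p. monom (coeff p i) i ^ q)"
    by (rule freshmans_dream_sum') (use assms in simp_all)
  finally show ?thesis by (simp add: monom_power mult.commute)
qed

text \<open>Frobenius is additive, so no cross terms arise: exponent \<open>q ^ i\<close> becomes
  \<open>q ^ Suc i\<close> and 0 stays 0.\<close>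

lemma affine_q_poly_power_char:
  fixes p :: "'a::field poly"
  assumes "prime CHAR('a)" and "q = CHAR('a) ^ n" and "affine_q_poly q p"
  shows "affine_q_poly q (p ^ q)"
proof -
  have q0: "q > 0" using assms(1,2) by (simp add: prime_gt_0_nat)
  have "m = 0 \<or> (\<exists>i. m = q ^ i)" if m: "coeff (p ^ q) m \<noteq> 0" for m
  proof -
    obtain i where "(if i * q = m then coeff p i ^ q else 0) \<noteq> 0"
      using m unfolding poly_power_char[OF assms(1,2)] coeff_sum coeff_monom
      by (rule sum.not_neutral_contains_not_neutral)
    then have i: "m = i * q" "coeff p i ^ q \<noteq> 0" by (auto split: if_splits)
    then have "coeff p i \<noteq> 0" using q0 by auto
    then have "i = 0 \<or> (\<exists>j. i = q ^ j)" using assms(3) by (auto simp: affine_q_poly_def)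
    then show ?thesis using i(1) by (metis mult_0 power_Suc2)
  qed
  then show ?thesis by (auto simp: affine_q_poly_def)
qed

text \<open>The quotient is a constant, zero when \<open>degree p < degree g\<close>. The remainder
  is thus a linear combination of \<open>p\<close> and \<open>g\<close>, which preserves the affine
  shape.\<close>

lemma mod_eq_diff_smult:
  fixes p g :: "'a::field poly"
  assumes "degree p \<le> degree g" and "degree g > 0"
  shows "p mod g = p - smult (coeff p (degree g) / lead_coeff g) g"
proof -
  let ?r = "p - smult (coeff p (degree g) / lead_coeff g) g"
  have g0: "g \<noteq> 0" using assms by auto
  have "degree ?r < degree g"
  proof (rule degree_lessI)
    show "\<forall>i\<ge>degree g. coeff ?r i = 0"
    proof (intro allI impI)
      fix i assume "i \<ge> degree g"
      then show "coeff ?r i = 0"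
        using assms g0 by (cases "i = degree g") (auto simp: coeff_eq_0)
    qed
  qed (use assms in auto)
  then have "?r mod g = ?r" by (rule mod_poly_less)
  moreover have "?r mod g = p mod g"
    by (simp add: poly_mod_diff_left mod_smult_left)
  ultimately show ?thesis by simp
qed

text \<open>Induction on \<open>k\<close>: the next remainder is the \<open>q\<close>-th power of
  the previous one, reduced. The degree bound keeps that power at degree at most
  \<open>q ^ d\<close>, so one constant multiple of \<open>g\<close> suffices. Stating the bound
  with the factor \<open>q\<close> also covers \<open>d = 0\<close>.\<close>

lemma affine_q_poly_monom_mod:
  fixes g :: "'a::field poly"
  assumes char: "prime CHAR('a)" "q = CHAR('a) ^ n" and "q > 1"
    and g: "affine_q_poly q g" and deg: "degree g = q ^ d"
  shows "affine_q_poly q (monom 1 (q ^ k) mod g) \<and> q * degree (monom 1 (q ^ k) mod g) \<le> q ^ d"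
proof -
  have degg: "degree g > 0" using deg \<open>q > 1\<close> by simp
  then have g0: "g \<noteq> 0" by auto
  have step: "affine_q_poly q (p mod g) \<and> q * degree (p mod g) \<le> q ^ d"
    if p: "affine_q_poly q p" "degree p \<le> q ^ d" for p
  proof
    show aff: "affine_q_poly q (p mod g)"
      using p g degg deg
      by (simp add: mod_eq_diff_smult affine_q_poly_diff affine_q_poly_smult)
    have less: "degree (p mod g) < q ^ d"
      using degree_mod_less'[OF g0, of p] degg deg by (cases "p mod g = 0") auto
    \<comment> \<open>A nonconstant affine remainder has degree \<open>q ^ i\<close>; being below
      \<open>q ^ d\<close>, it is at most \<open>q ^ d / q\<close>.\<close>
    show "q * degree (p mod g) \<le> q ^ d"
    proof (cases "degree (p mod g) = 0")
      case False
      then have "lead_coeff (p mod g) \<noteq> 0" by auto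
      then have "degree (p mod g) = 0 \<or> (\<exists>i. degree (p mod g) = q ^ i)"
        using aff unfolding affine_q_poly_def by (elim allE impE)
      then obtain i where i: "degree (p mod g) = q ^ i" using False by auto
      then have "Suc i \<le> d" using less \<open>q > 1\<close> by simp
      then have "q ^ Suc i \<le> q ^ d" using \<open>q > 1\<close> by (intro power_increasing) auto
      then show ?thesis using i by simp
    qed auto
  qed
  show ?thesis
  proof (induction k)
    case 0
    have "affine_q_poly q (monom (1::'a) (q ^ 0))"
      unfolding affine_q_poly_def by (metis coeff_monom)
    moreover have "degree (monom (1::'a) (q ^ 0)) \<le> q ^ d"
      using \<open>q > 1\<close> by (simp add: degree_monom_eq)
    ultimately show ?case by (rule step)
  next
    case (Suc k)
    let ?r = "monom 1 (q ^ k) mod g"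
    have "monom 1 (q ^ Suc k) mod g = monom 1 (q ^ k) ^ q mod g"
      by (simp add: monom_power mult.commute)
    also have "\<dots> = ?r ^ q mod g" by (simp add: power_mod)
    finally have eq: "monom 1 (q ^ Suc k) mod g = ?r ^ q mod g" .
    have "degree (?r ^ q) \<le> q ^ d"
      using degree_power_le[of ?r q] Suc.IH by (simp add: mult.commute)
    then show ?case
      unfolding eq using Suc.IH char by (intro step affine_q_poly_power_char) auto
  qed
qed

text \<open>Translation by 1 permutes the finite set \<open>Fq\<close>; comparing the sums over
  \<open>Fq\<close> before and after gives \<open>q = 0\<close> in the field, so the characteristic
  divides a prime power.\<close>

lemma prime_CHAR_of_finite_subfield:
  fixes Fq :: "'a::field set"
  assumes "primepow q" and sub: "subfield Fq (ring_of_type_algebra :: 'a ring)"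
    and card: "card Fq = q"
  shows "\<exists>n. prime CHAR('a) \<and> q = CHAR('a) ^ n"
proof -
  obtain p n where pn: "prime p" "n > 0" "q = p ^ n"
    using assms(1) by (auto simp: primepow_def)
  have "q > 0" using assms(1) by (rule primepow_gt_0_nat)
  then have fin: "finite Fq" using card card.infinite by fastforce
  have "subring Fq (ring_of_type_algebra :: 'a ring)"
    using sub by (simp add: subfield_def subdomain_def subcring_def domain_def)
  then have "x + 1 \<in> Fq" if "x \<in> Fq" for x
    using subringE(3,7) that by (fastforce simp: ring_of_type_algebra_def)
  then have "(\<lambda>x. x + 1) ` Fq \<subseteq> Fq" by auto
  then have "(\<lambda>x. x + 1) ` Fq = Fq"
    by (intro endo_inj_surj fin) (auto simp: inj_on_def)
  then have "bij_betw (\<lambda>x. x + 1) Fq Fq" by (auto simp: bij_betw_def inj_on_def)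
  then have "(\<Sum>x\<in>Fq. x + 1) = (\<Sum>x\<in>Fq. x)"
    by (rule sum.reindex_bij_betw)
  then have "of_nat q = (0::'a)" using card by (simp add: sum.distrib)
  then have dvd: "CHAR('a) dvd q" by (simp add: of_nat_eq_0_iff_char_dvd)
  then have "CHAR('a) > 0" using \<open>q > 0\<close> by (auto intro: Nat.gr0I)
  then have "prime CHAR('a)" by (rule prime_CHAR_semidom)
  moreover from this have "CHAR('a) = p"
    using dvd pn by (metis prime_dvd_power primes_dvd_imp_eq)
  ultimately show ?thesis using pn by auto
qed

lemma pderiv_q_poly:
  fixes c :: "nat \<Rightarrow> 'a::field"
  assumes "of_nat q = (0::'a)"
  shows "pderiv (q_poly q d c) = [:c 0:]"
proof -
  have "pderiv (q_poly q d c) = (\<Sum>i\<le>d. if i = 0 then [:c 0:] else 0)"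
    unfolding q_poly_def higher_pderiv_sum[of 1, simplified]
    by (intro sum.cong) (use assms in \<open>auto simp: pderiv_monom monom_0 power_0_left\<close>)
  then show ?thesis by simp
qed

theorem theorem6:
  fixes q d s :: nat
    and Fq :: "'a::field set"
    and c :: "nat \<Rightarrow> 'a"
    and k :: "nat \<Rightarrow> nat"
  assumes "primepow q"
    and "subfield Fq (ring_of_type_algebra :: 'a ring)"
    and "card Fq = q"
    and "c d \<noteq> 0"
    and "1 \<le> s" and "s < q"
  shows "(\<Prod>j=1..s. A_coeff (q_poly q d c) (q ^ k j - 1)) =
         c 0 ^ (s - 1) * A_coeff (q_poly q d c) ((\<Sum>j=1..s. q ^ k j) - 1)"
proof -
  obtain n where char: "prime CHAR('a)" "q = CHAR('a) ^ n"
    using prime_CHAR_of_finite_subfield[OF assms(1-3)] by blast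
  have q: "q > 1" using primepow_gt_Suc_0[OF assms(1)] by simp
  then have "n > 0" using char by (cases n) auto
  then have q0: "of_nat q = (0::'a)" by (simp add: char(2) of_nat_power)
  define f where "f = q_poly q d c"
  define g where "g = f - 1"
  define r where "r j = monom 1 (q ^ k j) mod g" for j
  have degf: "degree f = q ^ d" using assms q by (simp add: f_def degree_q_poly)
  have degg: "degree g = q ^ d"
    unfolding g_def using degf q degree_add_eq_left[of "- 1" f] by simp
  have affg: "affine_q_poly q g"
    unfolding g_def f_def
    by (intro affine_q_poly_diff affine_q_poly_q_poly) (auto simp: affine_q_poly_def)
  have A: "A_coeff f (m - 1) = c 0 * poly (monom 1 m mod g) 0" if "m \<ge> 1" for m
    unfolding g_def
  proof (rule A_coeff_eq_mod)
    show "poly f 0 = 0"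
      using q by (simp add: f_def q_poly_def poly_sum poly_monom power_0_left)
  qed (use that degf q pderiv_q_poly[OF q0] in \<open>auto simp: f_def\<close>)
  have deg_r: "q * degree (r j) \<le> q ^ d" for j
    unfolding r_def using affine_q_poly_monom_mod[OF char q affg degg] by blast
  \<comment> \<open>Each of the \<open>s < q\<close> factors has degree at most
    \<open>q ^ d / q\<close>, so the product stays below degree \<open>q ^ d\<close> and is its own
    remainder.\<close>
  have "q * degree (\<Prod>j=1..s. r j) \<le> q * (\<Sum>j=1..s. degree (r j))"
    by (intro mult_left_mono degree_prod_sum_le[unfolded o_def]) auto
  also have "\<dots> \<le> (\<Sum>j=1..s. q ^ d)"
    unfolding sum_distrib_left by (intro sum_mono deg_r)
  also have "\<dots> < q * q ^ d" using assms(6) q by simp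
  finally have "degree (\<Prod>j=1..s. r j) < degree g" by (simp add: degg)
  then have "(\<Prod>j=1..s. r j) = (\<Prod>j=1..s. r j) mod g" by (simp add: mod_poly_less)
  also have "\<dots> = (\<Prod>j=1..s. monom 1 (q ^ k j)) mod g"
    unfolding r_def by (rule mod_prod_eq)
  also have "(\<Prod>j=1..s. monom (1::'a) (q ^ k j)) = monom 1 (\<Sum>j=1..s. q ^ k j)"
    by (simp add: monom_altdef power_sum)
  finally have r: "monom 1 (\<Sum>j=1..s. q ^ k j) mod g = (\<Prod>j=1..s. r j)" ..
  \<comment> \<open>The exponent is at least \<open>s\<close>, hence positive, as \<open>A\<close>
    requires.\<close>
  have "(\<Sum>j=1..s. 1) \<le> (\<Sum>j=1..s. q ^ k j)"
    using q by (intro sum_mono) simp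
  then have "A_coeff f ((\<Sum>j=1..s. q ^ k j) - 1) = c 0 * (\<Prod>j=1..s. poly (r j) 0)"
    using assms(5) by (subst A) (simp_all only: r poly_prod, simp)
  moreover have "(\<Prod>j=1..s. A_coeff f (q ^ k j - 1)) = (\<Prod>j=1..s. c 0 * poly (r j) 0)"
    unfolding r_def using q by (intro prod.cong refl A) simp
  \<comment> \<open>The product of coefficients carries \<open>s\<close> factors \<open>c 0\<close>,
    the single coefficient only one.\<close>
  moreover have "c 0 ^ s = c 0 ^ (s - 1) * c 0"
    using assms(5) by (subst power_minus_mult) auto
  ultimately show ?thesis by (simp add: prod.distrib f_def)
qed

end
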